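(* Let $q$ be a prime power, $m$ a positive integer, and $k=q^\ell+1$ where $\ell$ is an integer with $1\le\ell<\frac m2$, $\ell\mid m$ and $m/\ell$ even. If $\gcd(k,q^m-1)\neq q^{m/2}+1$, then the Waring number satisfies $g(q^\ell+1,q^m)=2$; that is, every element of $\mathbb F_{q^m}$ can be written as $x^{q^\ell+1}+y^{q^\ell+1}$ with $x,y\in\mathbb F_{q^m}$, and not every element is a single $(q^\ell+1)$-th power.
   Context: For a positive integer $k$ and a prime power $Q$, the Waring number $g(k,Q)$ is the smallest integer $s$ such that every element of $\mathbb F_Q$ can be written as a sum $x_1^k+\cdots+x_s^k$ with $x_i\in\mathbb F_Q$. *)

theory Defs
  imports Complex_Main "HOL-Library.Cardinality" "HOL-Number_Theory.Prime_Powers"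
begin

text \<open>
  A finite field with \<open>Q\<close> elements is a type of class \<open>field\<close> and \<open>finite\<close> whose
  cardinality is \<open>Q\<close>. The Waring number \<open>g(k, Q)\<close> depends only on the isomorphism type
  of this field, so it is defined for the type representing it.

  \<open>LEAST\<close> is unspecified when no number of summands suffices, so an equation on
  \<open>waring_number\<close> alone does not state that such representations exist.
\<close>

definition sums_of_powers_cover :: "'a::{field,finite} itself \<Rightarrow> nat \<Rightarrow> nat \<Rightarrow> bool" where
  "sums_of_powers_cover F k s \<longleftrightarrow> (\<forall>a::'a. \<exists>x :: nat \<Rightarrow> 'a. a = (\<Sum>i<s. x i ^ k))"

definition waring_number :: "'a::{field,finite} itself \<Rightarrow> nat \<Rightarrow> nat" where
  "waring_number F k = (LEAST s. sums_of_powers_cover F k s)"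

end

(* Put Q = q^l, so that the field F has Q^(2u) elements with u >= 2 and contains E of order Q^2.
   If eps^(Q+1) = -1, then (z+1)^(Q+1) + (eps z)^(Q+1) = z^Q + z + 1. The elements z^Q + z form
   the kernel W of an alternating trace, and 1 is in W. So a is a sum of two (Q+1)-th powers as
   soon as a y^(Q+1) is in W for some nonzero y. The condition a y^(Q+1) in W says that y is an
   isotropic vector of a Hermitian form over E in u >= 2 variables, and such a form has one. *)

theory Submission
  imports Defs "HOL-Number_Theory.Residues" "HOL-Computational_Algebra.Polynomial"
begin

section \<open>Counting roots and powers in finite fields\<close>

lemma card_le_mult_card_image:
  assumes "finite A" and "\<And>y. y \<in> f ` A \<Longrightarrow> card {x \<in> A. f x = y} \<le> c"
  shows "card A \<le> c * card (f ` A)"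
proof -
  have "card A = card (\<Union>y\<in>f ` A. {x \<in> A. f x = y})"
    by (rule arg_cong[where f = card]) auto
  also have "\<dots> \<le> (\<Sum>y\<in>f ` A. card {x \<in> A. f x = y})"
    using assms(1) by (intro card_UN_le) simp
  also have "\<dots> \<le> of_nat (card (f ` A)) * c"
    by (rule sum_bounded_above) (use assms(2) in auto)
  finally show ?thesis by (simp add: mult.commute)
qed

lemma card_power_eq_le:
  fixes y :: "'a::idom"
  assumes "d > 0"
  shows "card {x. x ^ d = y} \<le> d"
proof -
  define p where "p = monom 1 d - [:y:]"
  have "coeff p d = 1"
    using assms by (simp add: p_def coeff_pCons split: nat.splits)
  hence "p \<noteq> 0" by auto
  have "{x. x ^ d = y} = {x. poly p x = 0}"
    by (auto simp: p_def poly_monom)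
  also have "card \<dots> \<le> degree p"
    by (rule card_poly_roots_bound) fact
  also have "\<dots> \<le> d"
    unfolding p_def by (intro degree_diff_le) (auto simp: degree_monom_le)
  finally show ?thesis .
qed

text \<open>The hypothesis \<open>d > 1\<close> keeps the linear term off the leading one. Later
  \<open>b = 1\<close> bounds the fibres of \<open>z ^ Q + z\<close>, and \<open>b = - 1\<close> the
  subfield of order \<open>Q ^ 2\<close>.\<close>

lemma card_trinomial_roots_le:
  fixes b c :: "'a::idom"
  assumes "d > 1"
  shows "card {z. z ^ d + b * z = c} \<le> d"
proof -
  define p where "p = monom 1 d + [:- c, b:]"
  have "coeff p d = 1"
    using assms by (simp add: p_def coeff_pCons split: nat.splits)
  hence "p \<noteq> 0" by auto
  have "{z. z ^ d + b * z = c} = {x. poly p x = 0}"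
    by (auto simp: p_def poly_monom algebra_simps eq_neg_iff_add_eq_0)
  also have "card \<dots> \<le> degree p"
    by (rule card_poly_roots_bound) fact
  also have "\<dots> \<le> d"
    unfolding p_def using assms by (intro degree_add_le) (auto simp: degree_monom_le)
  finally show ?thesis .
qed

text \<open>Multiplication by \<open>x\<close> permutes the nonzero elements, so it leaves their
  product unchanged.\<close>

lemma finite_field_power_card_minus_1:
  fixes x :: "'a::{field,finite}"
  assumes "x \<noteq> 0"
  shows "x ^ (CARD('a) - 1) = 1"
proof -
  have "(\<Prod>y\<in>UNIV-{0}. x * y) = (\<Prod>y\<in>UNIV-{0}. y)"
    by (rule prod.reindex_bij_witness[of _ "\<lambda>y. y / x" "\<lambda>y. x * y"]) (use assms in auto)
  hence "x ^ (CARD('a) - 1) * \<Prod>(UNIV - {0 :: 'a}) = \<Prod>(UNIV - {0})"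
    by (simp add: prod.distrib)
  thus ?thesis by simp
qed

text \<open>The map \<open>x \<mapsto> x ^ d\<close> on nonzero elements has fibres of size at most \<open>d\<close> and takes values in the
  at most \<open>e\<close> roots of \<open>z ^ e = 1\<close>, so it must hit all of them.\<close>

lemma finite_field_ex_root:
  fixes z :: "'a::{field,finite}"
  assumes de: "CARD('a) - 1 = d * e" and z: "z ^ e = 1"
  shows "\<exists>x. x ^ d = z"
proof -
  have card: "card (UNIV - {0 :: 'a}) = d * e"
    using de by simp
  have "CARD('a) - 1 > 0"
    using card_mono[of UNIV "{0, 1 :: 'a}"] by simp
  hence pos: "d > 0" "e > 0" unfolding de by simp_all
  let ?I = "(\<lambda>x :: 'a. x ^ d) ` (UNIV - {0})"
  have "d * e \<le> d * card ?I"
    unfolding card[symmetric]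
  proof (rule card_le_mult_card_image)
    fix y :: 'a
    have "card {x \<in> UNIV - {0}. x ^ d = y} \<le> card {x. x ^ d = y}"
      by (rule card_mono) auto
    also have "\<dots> \<le> d" by (rule card_power_eq_le) fact
    finally show "card {x \<in> UNIV - {0}. x ^ d = y} \<le> d" .
  qed auto
  hence "e \<le> card ?I" using pos by simp
  moreover have "card {z :: 'a. z ^ e = 1} \<le> e"
    by (rule card_power_eq_le) fact
  moreover have "?I \<subseteq> {z. z ^ e = 1}"
    using finite_field_power_card_minus_1[where 'a = 'a] unfolding de power_mult by auto
  ultimately have "?I = {z. z ^ e = 1}"
    by (intro card_seteq) auto
  with z have "z \<in> ?I" by simp
  thus ?thesis by blast
qed

lemma finite_field_freshmans_dream:
  fixes x y :: "'a::{field,finite}"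
  assumes "prime p" "CARD('a) = p ^ n"
  shows "(x + y) ^ (p ^ j) = x ^ (p ^ j) + y ^ (p ^ j)"
proof -
  have prime: "prime CHAR('a)"
    by (rule prime_CHAR_semidom) (simp add: finite_imp_CHAR_pos)
  have "CHAR('a) dvd p ^ n"
    using CHAR_dvd_CARD[where 'a = 'a] assms(2) by simp
  hence "CHAR('a) = p"
    using prime assms(1) prime_dvd_power primes_dvd_imp_eq by blast
  thus ?thesis
    by (intro freshmans_dream') (use prime in auto)
qed

text \<open>\<open>Q\<close> will be \<open>q ^ l\<close>. Membership in the subfields of order
  \<open>Q\<close> and \<open>Q ^ 2\<close> is expressed by \<open>r ^ Q = r\<close> and
  \<open>c ^ (Q ^ 2) = c\<close>.\<close>

locale frobenius_square_extension =
  fixes F :: "'a::{field,finite} itself" and Q u :: nat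
  assumes Q_gt_1: "Q > 1" and u_gt_1: "u > 1"
    and card_F: "CARD('a) = (Q ^ 2) ^ u"
    and frob_add: "(x + y :: 'a) ^ Q = x ^ Q + y ^ Q"
begin

section \<open>Frobenius and trace identities\<close>

lemma frob_diff: "(x - y :: 'a) ^ Q = x ^ Q - y ^ Q"
  using frob_add[of "x - y" y] by simp

lemma frob_minus: "(- x :: 'a) ^ Q = - (x ^ Q)"
  using frob_diff[of 0 x] Q_gt_1 by simp

lemma frob_sum: "(\<Sum>i\<in>I. f i :: 'a) ^ Q = (\<Sum>i\<in>I. f i ^ Q)"
  using Q_gt_1 by (induction I rule: infinite_finite_induct) (auto simp: frob_add)

lemma frob_frob: "((x :: 'a) ^ Q) ^ Q = x ^ (Q ^ 2)"
  by (simp add: power2_eq_square power_mult)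

lemma frob2_add: "(x + y :: 'a) ^ (Q ^ 2) = x ^ (Q ^ 2) + y ^ (Q ^ 2)"
  by (simp add: frob_add flip: frob_frob)

lemma frob2_sum: "(\<Sum>i\<in>I. f i :: 'a) ^ (Q ^ 2) = (\<Sum>i\<in>I. f i ^ (Q ^ 2))"
  by (simp add: frob_sum flip: frob_frob)

lemma frob2_iter_add: "(x + y :: 'a) ^ ((Q ^ 2) ^ n) = x ^ ((Q ^ 2) ^ n) + y ^ ((Q ^ 2) ^ n)"
  by (induction n) (simp_all add: frob2_add power_mult power_Suc2 del: power_Suc)

text \<open>\<open>tr\<close> is the trace to the subfield of order \<open>Q\<^sup>2\<close>, and \<open>alt_tr w\<close> is the alternating sum
  \<open>w - w ^ Q + w ^ (Q ^ 2) - \<dots>\<close> of all \<open>2 * u\<close> conjugates over the subfield of order \<open>Q\<close>.\<close>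

definition tr :: "'a \<Rightarrow> 'a" where
  "tr w = (\<Sum>i<u. w ^ ((Q ^ 2) ^ i))"

definition alt_tr :: "'a \<Rightarrow> 'a" where
  "alt_tr w = tr w - tr w ^ Q"

lemma tr_add: "tr (x + y) = tr x + tr y"
  by (simp add: tr_def frob2_iter_add sum.distrib)

lemma tr_diff: "tr (x - y) = tr x - tr y"
  using tr_add[of "x - y" y] by simp

lemma tr_minus: "tr (- x) = - tr x"
  using tr_diff[of x x] tr_diff[of 0 x] by simp

lemma tr_mult:
  assumes "c ^ (Q ^ 2) = c"
  shows "tr (c * w) = c * tr w"
proof -
  have "c ^ ((Q ^ 2) ^ i) = c" for i
    by (induction i) (simp_all add: assms power_mult)
  thus ?thesis by (simp add: tr_def power_mult_distrib sum_distrib_left)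
qed

lemma power_card_F: "(w :: 'a) ^ ((Q ^ 2) ^ u) = w"
proof (cases "w = 0")
  case False
  have "w ^ Suc (CARD('a) - 1) = w"
    using finite_field_power_card_minus_1[OF False] by (simp only: power_Suc) simp
  moreover have "Suc (CARD('a) - 1) = (Q ^ 2) ^ u"
    using Q_gt_1 by (simp add: card_F)
  ultimately show ?thesis by (simp only:)
qed (use Q_gt_1 in auto)

text \<open>The exponents shift by one place, and the last term wraps around to \<open>w\<close> by
  \<open>power_card_F\<close>.\<close>

lemma tr_power: "tr (w ^ (Q ^ 2)) = tr w"
proof -
  have "tr (w ^ (Q ^ 2)) = (\<Sum>i<u. w ^ ((Q ^ 2) ^ Suc i))"
    by (simp add: tr_def power_mult)
  also have "\<dots> + w = (\<Sum>i<Suc u. w ^ ((Q ^ 2) ^ i))"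
    by (simp add: sum.lessThan_Suc_shift del: sum.lessThan_Suc)
  also have "\<dots> = tr w + w"
    by (simp add: tr_def power_card_F)
  finally show ?thesis by simp
qed

lemma power_tr: "tr w ^ (Q ^ 2) = tr w"
proof -
  have "tr w ^ (Q ^ 2) = tr (w ^ (Q ^ 2))"
    by (simp add: tr_def frob2_sum flip: power_mult) (simp add: mult.commute)
  thus ?thesis by (simp add: tr_power)
qed

section \<open>The alternating trace and its kernel\<close>

lemma alt_tr_add: "alt_tr (x + y) = alt_tr x + alt_tr y"
  by (simp add: alt_tr_def tr_add frob_add)

lemma alt_tr_diff: "alt_tr (x - y) = alt_tr x - alt_tr y"
  by (simp add: alt_tr_def tr_diff frob_diff)

lemma alt_tr_mult:
  assumes "r ^ Q = r"
  shows "alt_tr (r * w) = r * alt_tr w"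
  using assms frob_frob[of r]
  by (simp add: alt_tr_def tr_mult power_mult_distrib algebra_simps)

text \<open>Traces are fixed by the power \<open>Q ^ 2\<close>, so the power \<open>Q\<close> swaps
  the two terms. Hence quotients of values of \<open>alt_tr\<close> lie in the subfield of order
  \<open>Q\<close>.\<close>

lemma power_alt_tr: "alt_tr w ^ Q = - alt_tr w"
  by (simp add: alt_tr_def frob_diff frob_frob power_tr)

lemma tr_frob: "tr (w ^ Q) = tr w ^ Q"
  by (simp add: tr_def frob_sum flip: power_mult) (simp add: mult.commute)

lemma alt_tr_artin_schreier: "alt_tr (z ^ Q + z) = 0"
  by (simp add: alt_tr_def tr_add frob_add tr_frob frob_frob power_tr)

lemma alt_tr_1: "alt_tr 1 = 0"
  using tr_frob[of 1] by (simp add: alt_tr_def)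

lemma card_alt_tr_kernel: "card {w. alt_tr w = 0} \<le> Q ^ (2 * u - 1)"
proof -
  define p :: "'a poly" where
    "p = (\<Sum>i<u. monom 1 ((Q ^ 2) ^ i) - monom 1 ((Q ^ 2) ^ i * Q))"
  \<comment> \<open>Only \<open>i = 0\<close> contributes a linear monomial, so \<open>p\<close> has
    linear coefficient 1 and is nonzero.\<close>
  have *: "(Q ^ 2) ^ i * Q \<noteq> 1" "(Q ^ 2) ^ i = 1 \<longleftrightarrow> i = 0" for i
    using Q_gt_1 by (auto simp flip: power_mult)
  have "coeff p 1 = (\<Sum>i<u. if i = 0 then 1 else 0)"
    unfolding p_def coeff_sum by (intro sum.cong refl) (use * in auto)
  also have "\<dots> = 1" using u_gt_1 by simp
  finally have "p \<noteq> 0" by auto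
  have "alt_tr w = poly p w" for w
    by (simp add: alt_tr_def p_def poly_sum poly_monom tr_def frob_sum sum_subtractf power_mult)
  hence "card {w. alt_tr w = 0} \<le> degree p"
    using card_poly_roots_bound[OF \<open>p \<noteq> 0\<close>] by simp
  also have "degree p \<le> Q ^ (2 * u - 1)"
    unfolding p_def
  proof (intro degree_sum_le degree_diff_le)
    fix i assume "i \<in> {..<u}"
    hence "Q ^ (2 * i) \<le> Q ^ (2 * u - 1)" "Q ^ (2 * i + 1) \<le> Q ^ (2 * u - 1)"
      using Q_gt_1 by (intro power_increasing; simp)+
    thus "degree (monom (1 :: 'a) ((Q ^ 2) ^ i)) \<le> Q ^ (2 * u - 1)"
      "degree (monom (1 :: 'a) ((Q ^ 2) ^ i * Q)) \<le> Q ^ (2 * u - 1)"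
      by (simp_all add: degree_monom_eq mult.commute flip: power_mult)
  qed simp
  finally show ?thesis .
qed

text \<open>An analogue of additive Hilbert 90, by counting: the fibres of \<open>z ^ Q + z\<close>
  have at most \<open>Q\<close> elements, so its image is at least as large as the kernel that
  contains it.\<close>

lemma alt_tr_eq_0_imp:
  assumes "alt_tr w = 0"
  shows "\<exists>z. z ^ Q + z = w"
proof -
  let ?I = "range (\<lambda>z :: 'a. z ^ Q + z)"
  have "CARD('a) \<le> Q * card ?I"
    by (rule card_le_mult_card_image) (use Q_gt_1 card_trinomial_roots_le[of Q "1 :: 'a"] in auto)
  moreover have "CARD('a) = Q * Q ^ (2 * u - 1)"
    unfolding card_F using u_gt_1 by (simp flip: power_mult power_Suc)
  ultimately have "Q ^ (2 * u - 1) \<le> card ?I"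
    using Q_gt_1 by simp
  hence "?I = {w. alt_tr w = 0}"
    using card_alt_tr_kernel by (intro card_seteq) (auto simp: alt_tr_artin_schreier)
  thus ?thesis using assms by (metis (mono_tags, lifting) imageE mem_Collect_eq)
qed

section \<open>Powers with exponent \<open>Q + 1\<close>\<close>

lemma CARD_factor: "\<exists>e. CARD('a) - 1 = (Q + 1) * ((Q - 1) * e)"
proof -
  have "[Q ^ 2 = 1] (mod Q ^ 2 - 1)"
    using Q_gt_1 by (simp add: cong_altdef_nat)
  from cong_pow[OF this, of u] have "Q ^ 2 - 1 dvd (Q ^ 2) ^ u - 1"
    using Q_gt_1 by (simp add: cong_altdef_nat)
  moreover have "Q ^ 2 - 1 = (Q + 1) * (Q - 1)"
    by (simp add: power2_eq_square algebra_simps)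
  ultimately show ?thesis
    unfolding card_F dvd_def by (simp only: mult.assoc)
qed

text \<open>Since \<open>r ^ (Q - 1) = 1\<close>, \<open>finite_field_ex_root\<close> applies with
  \<open>d = Q + 1\<close>.\<close>

lemma ex_norm_eq:
  assumes "r ^ Q = r" "r \<noteq> (0 :: 'a)"
  shows "\<exists>c. c ^ (Q + 1) = r"
proof -
  obtain e where e: "CARD('a) - 1 = (Q + 1) * ((Q - 1) * e)"
    using CARD_factor by blast
  have "r * r ^ (Q - 1) = r * 1"
    using assms(1) Q_gt_1 by (simp flip: power_Suc)
  hence "r ^ (Q - 1) = 1" using assms(2) by simp
  hence "r ^ ((Q - 1) * e) = 1" by (simp add: power_mult)
  thus ?thesis by (rule finite_field_ex_root[OF e])
qed

text \<open>Otherwise all nonzero elements would be roots of \<open>a ^ n = 1\<close> with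
  \<open>n = (CARD('a) - 1) div (Q + 1)\<close>, which are too few.\<close>

lemma not_all_powers: "\<exists>a :: 'a. \<forall>x. a \<noteq> x ^ (Q + 1)"
proof (rule ccontr)
  assume "\<not> ?thesis"
  hence surj: "\<exists>x. a = x ^ (Q + 1)" for a :: 'a by blast
  obtain e where e: "CARD('a) - 1 = (Q + 1) * ((Q - 1) * e)"
    using CARD_factor by blast
  let ?n = "(Q - 1) * e"
  have "CARD('a) - 1 > 0"
    using card_mono[of UNIV "{0, 1 :: 'a}"] by simp
  hence n: "?n > 0" using e by (metis gr0I mult_0_right less_numeral_extra(3))
  have "a ^ ?n = 1" if "a \<noteq> 0" for a :: 'a
  proof -
    obtain x where x: "a = x ^ (Q + 1)" using surj by blast
    with that have "x \<noteq> 0" by auto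
    hence "x ^ ((Q + 1) * ?n) = 1"
      using finite_field_power_card_minus_1[of x] unfolding e by simp
    thus ?thesis using x by (metis power_mult)
  qed
  hence "card (UNIV - {0 :: 'a}) \<le> card {a :: 'a. a ^ ?n = 1}"
    by (intro card_mono) auto
  also have "\<dots> \<le> ?n" by (rule card_power_eq_le) fact
  finally have "(Q + 1) * ?n \<le> 1 * ?n" using e by simp
  hence "Q + 1 \<le> 1" using n by (simp only: mult_le_cancel2)
  thus False using Q_gt_1 by simp
qed

section \<open>Isotropic vectors and sums of two powers\<close>

text \<open>
  The map \<open>y \<mapsto> alt_tr (a y\<^bsup>Q+1\<^esup>)\<close> is, up to a scalar, a Hermitian form over
  the subfield of order \<open>Q\<^sup>2\<close> in \<open>u \<ge> 2\<close> variables. If the vector \<open>1\<close> is not isotropic,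
  take \<open>y \<noteq> 0\<close> orthogonal to it; some \<open>c + y\<close> with \<open>c\<close> in the subfield is then isotropic
  because the norm is surjective. Here \<open>S y\<close> is the Hermitian pairing of \<open>1\<close> and \<open>y\<close>.
\<close>

lemma ex_isotropic:
  fixes a :: 'a
  shows "\<exists>y. y \<noteq> 0 \<and> alt_tr (a * y ^ (Q + 1)) = 0"
proof (cases "alt_tr a = 0")
  case True
  thus ?thesis by (intro exI[of _ 1]) simp
next
  case nz: False
  define S where "S = (\<lambda>y. tr (a * y) - tr (a * y ^ Q) ^ Q)"
  \<comment> \<open>\<open>S\<close> takes values in the subfield of order \<open>Q ^ 2\<close>,
    which is smaller than the field because \<open>u > 1\<close>. As \<open>S\<close> is additive, a
    collision yields a nonzero vector orthogonal to 1.\<close>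
  have "\<not> inj S"
  proof
    assume "inj S"
    have "S y ^ (Q ^ 2) = S y" for y
    proof -
      have "S y ^ (Q ^ 2) = tr (a * y) ^ (Q ^ 2) - (tr (a * y ^ Q) ^ (Q ^ 2)) ^ Q"
        unfolding S_def by (simp add: frob_diff flip: frob_frob)
      thus ?thesis by (simp add: S_def power_tr)
    qed
    hence "range S \<subseteq> {z. z ^ (Q ^ 2) = z}" by auto
    have "CARD('a) = card (range S)"
      using \<open>inj S\<close> by (simp add: card_image)
    also have "\<dots> \<le> card {z :: 'a. z ^ (Q ^ 2) = z}"
      by (rule card_mono) (use \<open>range S \<subseteq> _\<close> in auto)
    also have "\<dots> \<le> Q ^ 2"
      using card_trinomial_roots_le[of "Q ^ 2" "- 1 :: 'a" 0] one_less_power[OF Q_gt_1, of 2] by simp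
    also have "\<dots> = (Q ^ 2) ^ 1" by simp
    also have "\<dots> < (Q ^ 2) ^ u"
      using one_less_power[OF Q_gt_1, of 2] u_gt_1 by (intro power_strict_increasing) auto
    finally show False by (simp add: card_F)
  qed
  then obtain y' y'' where y': "y' \<noteq> y''" "S y' = S y''"
    by (auto simp: inj_def)
  define y where "y = y' - y''"
  have "y \<noteq> 0" using y' by (simp add: y_def)
  have Sy: "S y = 0"
  proof -
    have "S y = S y' - S y''"
      by (simp add: S_def y_def frob_diff tr_diff right_diff_distrib)
    thus ?thesis using y'(2) by simp
  qed
  \<comment> \<open>Orthogonality makes \<open>P\<close> and \<open>R\<close> conjugate, so the
    cross terms \<open>c ^ Q * P + c * R\<close> are fixed by the power \<open>Q\<close> and vanish
    in \<open>alt_tr\<close>.\<close>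
  define P R where "P = tr (a * y)" and "R = tr (a * y ^ Q)"
  have P: "P = R ^ Q" using Sy by (simp add: S_def P_def R_def)
  have R: "R = P ^ Q" unfolding P frob_frob by (simp add: R_def power_tr)
  have cQ: "(c ^ Q) ^ Q ^ 2 = c ^ Q" if "c ^ (Q ^ 2) = c" for c :: 'a
    using that by (metis mult.commute power_mult)
  have form: "alt_tr (a * (c + y) ^ (Q + 1)) = c ^ (Q + 1) * alt_tr a + alt_tr (a * y ^ (Q + 1))"
    if c: "c ^ (Q ^ 2) = c" for c
  proof -
    have "a * (c + y) ^ (Q + 1) =
        c ^ (Q + 1) * a + a * y ^ (Q + 1) + (c ^ Q * (a * y) + c * (a * y ^ Q))"
      by (simp add: frob_add algebra_simps)
    moreover have "tr (c ^ Q * (a * y) + c * (a * y ^ Q)) = c ^ Q * P + c * R"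
      using c cQ[OF c] by (simp add: tr_add tr_mult P_def R_def)
    hence "alt_tr (c ^ Q * (a * y) + c * (a * y ^ Q)) = 0"
      using c by (simp add: alt_tr_def frob_add power_mult_distrib frob_frob flip: P R)
    moreover have "(c ^ (Q + 1)) ^ Q = c ^ (Q + 1)"
      using c by (simp add: power_mult_distrib frob_frob mult.commute)
    ultimately show ?thesis
      by (simp add: alt_tr_add alt_tr_mult)
  qed
  show ?thesis
  proof (cases "alt_tr (a * y ^ (Q + 1)) = 0")
    case True
    thus ?thesis using \<open>y \<noteq> 0\<close> by blast
  next
    case False
    \<comment> \<open>The value of \<open>c ^ (Q + 1)\<close> that makes the right-hand side of
      \<open>form\<close> zero.\<close>
    define r where "r = - alt_tr (a * y ^ (Q + 1)) / alt_tr a"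
    have "r \<noteq> 0" using False nz by (simp add: r_def)
    have r: "r ^ Q = r"
      by (simp add: r_def power_divide frob_minus power_alt_tr)
    obtain c where c: "c ^ (Q + 1) = r"
      using ex_norm_eq[OF r \<open>r \<noteq> 0\<close>] by blast
    have "c \<noteq> 0" using c \<open>r \<noteq> 0\<close> by auto
    \<comment> \<open>\<open>form\<close> needs \<open>c\<close> in the subfield of order
      \<open>Q ^ 2\<close>; this follows from its norm \<open>r\<close> being fixed by the power
      \<open>Q\<close>.\<close>
    have "(c ^ (Q + 1)) ^ Q = c ^ (Q + 1)" using r c by simp
    hence "c ^ Q * c ^ (Q ^ 2) = c ^ Q * c"
      by (simp add: power_mult_distrib frob_frob mult.commute)
    hence c2: "c ^ (Q ^ 2) = c" using \<open>c \<noteq> 0\<close> by simp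
    \<comment> \<open>A vector \<open>y = - c\<close> would be a nonzero multiple of 1, which is not
      orthogonal to the non-isotropic vector 1.\<close>
    have "c + y \<noteq> 0"
    proof
      assume "c + y = 0"
      hence "y = - c" by (simp add: eq_neg_iff_add_eq_0 add.commute)
      hence "S y = - tr (c * a) + tr (c ^ Q * a) ^ Q"
        by (simp add: S_def frob_minus tr_minus mult.commute)
      also have "\<dots> = - (c * alt_tr a)"
        using c2 cQ[OF c2]
        by (simp add: tr_mult power_mult_distrib frob_frob alt_tr_def right_diff_distrib)
      finally show False using Sy \<open>c \<noteq> 0\<close> nz by simp
    qed
    moreover have "alt_tr (a * (c + y) ^ (Q + 1)) = 0"
      using form[OF c2] c nz by (simp add: r_def)
    ultimately show ?thesis by blast
  qed
qed

lemma sum_two_powers: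
  fixes a :: 'a
  shows "\<exists>x y. a = x ^ (Q + 1) + y ^ (Q + 1)"
proof -
  obtain y where y: "y \<noteq> 0" "alt_tr (a * y ^ (Q + 1)) = 0"
    using ex_isotropic by blast
  \<comment> \<open>The 1 removed here is the constant term of \<open>z ^ Q + z + 1\<close>.\<close>
  have "alt_tr (a * y ^ (Q + 1) - 1) = 0"
    using y(2) by (simp add: alt_tr_diff alt_tr_1)
  then obtain z where z: "z ^ Q + z = a * y ^ (Q + 1) - 1"
    using alt_tr_eq_0_imp by blast
  have "(- 1 :: 'a) ^ Q = - 1"
    by (simp add: frob_minus)
  then obtain \<epsilon> :: 'a where \<epsilon>: "\<epsilon> ^ (Q + 1) = - 1"
    using ex_norm_eq[of "- 1"] by auto
  have "(z + 1) ^ (Q + 1) + (\<epsilon> * z) ^ (Q + 1) = (z + 1) ^ (Q + 1) - z ^ (Q + 1)"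
    by (simp only: power_mult_distrib \<epsilon>) simp
  also have "\<dots> = z ^ Q + z + 1"
    by (simp add: frob_add algebra_simps)
  also have "\<dots> = a * y ^ (Q + 1)" using z by simp
  finally have "a = ((z + 1) / y) ^ (Q + 1) + (\<epsilon> * z / y) ^ (Q + 1)"
    using y(1) by (simp only: power_divide) (simp add: field_simps)
  thus ?thesis by blast
qed

end

section \<open>The Waring number\<close>

theorem theorem7p1:
  fixes q m l k :: nat
  assumes "primepow q"
    and "m > 0"
    and "CARD('a) = q ^ m"
    and "k = q ^ l + 1"
    and "1 \<le> l" and "real l < real m / 2"
    and "l dvd m" and "even (m div l)"
    and "gcd k (q ^ m - 1) \<noteq> q ^ (m div 2) + 1"
  shows "waring_number TYPE('a::{field,finite}) k = 2
    \<and> (\<forall>a::'a. \<exists>x y::'a. a = x ^ k + y ^ k)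
    \<and> \<not> (\<forall>a::'a. \<exists>x::'a. a = x ^ k)"
proof -
  obtain p n where p: "prime p" "n > 0" "q = p ^ n"
    using assms(1) by (auto simp: primepow_def)
  obtain u where "m div l = 2 * u" using assms(8) by blast
  hence m: "m = l * (2 * u)" using assms(7) by (metis dvd_mult_div_cancel)
  \<comment> \<open>The strict bound excludes \<open>u = 1\<close>, where the Hermitian form would
    have a single variable.\<close>
  have "2 * l < m" using assms(6) by linarith
  hence "u > 1" using m by (cases "u = 0"; cases "u = 1") auto
  have "q > 1" unfolding p(3) using p prime_gt_1_nat by (intro one_less_power) auto
  interpret frobenius_square_extension "TYPE('a)" "q ^ l" u
  proof
    show "q ^ l > 1" using \<open>q > 1\<close> assms(5) by (intro one_less_power) auto
    show "CARD('a) = ((q ^ l) ^ 2) ^ u"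
      by (simp add: assms(3) m power_mult)
    fix x y :: 'a
    show "(x + y) ^ (q ^ l) = x ^ (q ^ l) + y ^ (q ^ l)"
      using finite_field_freshmans_dream[OF p(1), where 'a = 'a and n = "n * m" and j = "n * l"]
        assms(3) p(3) by (simp add: power_mult)
  qed fact
  have two: "\<exists>x y. a = x ^ k + y ^ k" for a :: 'a
    using sum_two_powers assms(4) by simp
  have one: "\<exists>a :: 'a. \<forall>x. a \<noteq> x ^ k"
    using not_all_powers assms(4) by simp
  have "waring_number TYPE('a) k = 2"
    unfolding waring_number_def
  proof (rule Least_equality)
    show "sums_of_powers_cover TYPE('a) k 2"
      unfolding sums_of_powers_cover_def
    proof
      fix a :: 'a
      obtain x y where "a = x ^ k + y ^ k" using two by blast
      thus "\<exists>x :: nat \<Rightarrow> 'a. a = (\<Sum>i<2. x i ^ k)"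
        by (intro exI[of _ "\<lambda>i. if i = 0 then x else y"]) (simp add: numeral_2_eq_2)
    qed
  next
    fix s assume s: "sums_of_powers_cover TYPE('a) k s"
    \<comment> \<open>The empty sum represents only 0.\<close>
    have "s \<noteq> 0"
    proof
      assume "s = 0"
      hence "(1 :: 'a) = 0" using s by (auto simp: sums_of_powers_cover_def)
      thus False by simp
    qed
    moreover have "s \<noteq> 1"
    proof
      assume "s = 1"
      hence "\<exists>x. a = x ^ k" for a :: 'a using s by (auto simp: sums_of_powers_cover_def)
      thus False using one by blast
    qed
    ultimately show "2 \<le> s" by simp
  qed
  thus ?thesis using one two by blast
qed

end
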